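(* Let $\mu$ be a non-degenerate probability measure supported on $[0,1]$ and symmetric about the line $u=1/2$, with cumulant generating function $K(\theta)=\log\int e^{\theta x}\mu(dx)$, and assume that the associated Cramér rate function $I(u)=\sup_{\theta\in\mathbb{R}}\{\theta u-K(\theta)\}$ is bounded on $[0,1]$ (i.e. $I(0)=I(1)$ is finite). Let $H_1$ be a single edge and $H_2$ a finite simple graph with $p\ge 2$ edges, and suppose that the equation $K'''(\theta)K'(\theta)=-(p-2)\left(K''(\theta)\right)^2$ has exactly one solution $\theta\in\mathbb{R}$. Then the phase transition curve $\beta_2=r(\beta_1)$ of the associated $2$-parameter edge-weighted exponential random graph model satisfies $$\lim_{\beta_1\to-\infty}\left|r(\beta_1)+\beta_1\right|=0.$$
   Context: For $\beta_2\ge0$ let $L(u;\beta_1,\beta_2)=\beta_1u+\beta_2u^p-\frac12I(u)$ for $u$ in the domain $\{I<\infty\}$. The limiting normalization constant of the $2$-parameter edge-weighted exponential random graph model with parameters $\beta=(\beta_1,\beta_2)$, edge-weight distribution $\mu$ and subgraphs $H_1,H_2$ is $\psi_\infty^\beta=\sup_uL(u;\beta_1,\beta_2)$. Phase transition curve: let $\theta_0$ be the unique solution of $K'''(\theta)K'(\theta)=-(p-2)(K''(\theta))^2$ and put $u_0=K'(\theta_0)$, $\beta_2^c=\frac{I''(u_0)}{2p(p-1)u_0^{p-2}}=\frac{1}{2p(p-1)K''(\theta_0)K'(\theta_0)^{p-2}}$ and $\beta_1^c=-\left(\frac{u_0I''(u_0)}{2(p-1)}-\frac12I'(u_0)\right)=\frac{\theta_0}{2}-\frac{K'(\theta_0)}{2(p-1)K''(\theta_0)}$.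 For $\beta_1<\beta_1^c$, $r(\beta_1)$ is the unique value of $\beta_2\ge 0$ for which $L(\cdot;\beta_1,\beta_2)$ has two distinct global maximizers; also $r(\beta_1^c)=\beta_2^c$. The phase transition curve is $\{(\beta_1,r(\beta_1)):\beta_1\le\beta_1^c\}$, a decreasing curve with endpoint the critical point $(\beta_1^c,\beta_2^c)$; off this curve $L(\cdot;\beta_1,\beta_2)$ has a unique global maximizer. *)

theory Defs
  imports "HOL-Probability.Probability"
begin

definition simple_graph :: "'v set \<Rightarrow> 'v set set \<Rightarrow> bool" where
  "simple_graph V E \<longleftrightarrow> finite V \<and> (\<forall>e\<in>E. e \<subseteq> V \<and> card e = 2)"

definition nondegenerate :: "real measure \<Rightarrow> bool" where
  "nondegenerate \<mu> \<longleftrightarrow> \<not> (\<exists>c. AE x in \<mu>. x = c)"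

definition cgf :: "real measure \<Rightarrow> real \<Rightarrow> real" where
  "cgf \<mu> \<theta> = ln (\<integral>x. exp (\<theta> * x) \<partial>\<mu>)"

definition rate :: "real measure \<Rightarrow> real \<Rightarrow> ereal" where
  "rate \<mu> u = (SUP \<theta>. ereal (\<theta> * u - cgf \<mu> \<theta>))"

definition rate_domain :: "real measure \<Rightarrow> real set" where
  "rate_domain \<mu> = {u. rate \<mu> u < \<infinity>}"

(* The term \<beta>\<^sub>1 * u belongs to the single edge H1, the term \<beta>\<^sub>2 * u ^ p to a graph H2 with
   p edges. L_fun is meaningful only on rate_domain \<mu>: real_of_ereal \<infinity> = 0. *)
definition L_fun :: "real measure \<Rightarrow> nat \<Rightarrow> real \<Rightarrow> real \<Rightarrow> real \<Rightarrow> real" where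
  "L_fun \<mu> p \<beta>\<^sub>1 \<beta>\<^sub>2 u = \<beta>\<^sub>1 * u + \<beta>\<^sub>2 * u ^ p - 1 / 2 * real_of_ereal (rate \<mu> u)"

definition global_maximizer ::
    "real measure \<Rightarrow> nat \<Rightarrow> real \<Rightarrow> real \<Rightarrow> real \<Rightarrow> bool" where
  "global_maximizer \<mu> p \<beta>\<^sub>1 \<beta>\<^sub>2 u \<longleftrightarrow> is_arg_max (L_fun \<mu> p \<beta>\<^sub>1 \<beta>\<^sub>2) (\<lambda>v. v \<in> rate_domain \<mu>) u"

definition critical_equation :: "real measure \<Rightarrow> nat \<Rightarrow> real \<Rightarrow> bool" where
  "critical_equation \<mu> p \<theta> \<longleftrightarrow>
     (deriv ^^ 3) (cgf \<mu>) \<theta> * deriv (cgf \<mu>) \<theta> = - (real p - 2) * ((deriv ^^ 2) (cgf \<mu>) \<theta>)\<^sup>2"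

definition theta0 :: "real measure \<Rightarrow> nat \<Rightarrow> real" where
  "theta0 \<mu> p = (THE \<theta>. critical_equation \<mu> p \<theta>)"

(* With I the rate, K the cgf and u0 = K'(\<theta>0), duality gives I'(u0) = \<theta>0 and
   I''(u0) = 1 / K''(\<theta>0); the critical point is where L' = L'' = L''' = 0 at u0. *)
definition beta1c :: "real measure \<Rightarrow> nat \<Rightarrow> real" where
  "beta1c \<mu> p = (let \<theta> = theta0 \<mu> p in
     \<theta> / 2 - deriv (cgf \<mu>) \<theta> / (2 * (real p - 1) * (deriv ^^ 2) (cgf \<mu>) \<theta>))"

definition beta2c :: "real measure \<Rightarrow> nat \<Rightarrow> real" where
  "beta2c \<mu> p = (let \<theta> = theta0 \<mu> p in
     1 / (2 * real p * (real p - 1) * (deriv ^^ 2) (cgf \<mu>) \<theta> * deriv (cgf \<mu>) \<theta> ^ (p - 2)))"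

(* The phase transition curve; its values are meaningful only for \<beta>\<^sub>1 \<le> beta1c \<mu> p. *)
definition transition_curve :: "real measure \<Rightarrow> nat \<Rightarrow> real \<Rightarrow> real" where
  "transition_curve \<mu> p \<beta>\<^sub>1 =
     (if \<beta>\<^sub>1 = beta1c \<mu> p then beta2c \<mu> p
      else (THE \<beta>\<^sub>2. \<beta>\<^sub>2 \<ge> 0 \<and>
              (\<exists>u v. u \<noteq> v \<and> global_maximizer \<mu> p \<beta>\<^sub>1 \<beta>\<^sub>2 u \<and> global_maximizer \<mu> p \<beta>\<^sub>1 \<beta>\<^sub>2 v)))"

end

theory Submission
  imports Defs
begin

text \<open>Write \<open>J\<close> for the rate function on \<open>[0, 1]\<close>, \<open>L u = \<beta>\<^sub>1 u + \<beta>\<^sub>2 u\<^sup>p - J u / 2\<close>, and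
\<open>\<beta>\<^sub>2 = s - \<beta>\<^sub>1\<close>. Then \<open>L u = s u\<^sup>p + \<beta>\<^sub>1 (u - u\<^sup>p) - J u / 2\<close>. As \<open>\<beta>\<^sub>1 \<rightarrow> -\<infinity>\<close>, the middle term becomes a
penalty that vanishes only at \<open>u = 0\<close> and \<open>u = 1\<close>, so the contest is between small \<open>u\<close> and \<open>u\<close> near 1.
Symmetry of the measure gives \<open>J 0 = J 1\<close>, so these two competitors differ by \<open>L 1 - L 0 = s\<close>: a tie
forces \<open>s\<close> to be small.

This is made precise in two lemmas. For \<open>\<epsilon> > 0\<close> and \<open>\<beta>\<^sub>1\<close> sufficiently negative, at \<open>s = \<epsilon>\<close> every point of
\<open>[0, 1/2]\<close> loses to 1 (\<open>eventually_lower_half_loses\<close>), and at \<open>s = -\<epsilon>\<close> every point of \<open>[1/2, 1]\<close>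
loses to 0 (\<open>eventually_upper_half_loses\<close>). The maxima of \<open>L\<close> over the two halves depend continuously
on \<open>\<beta>\<^sub>2\<close>, so they agree at some \<open>s\<close> with \<open>\<bar>s\<bar> \<le> \<epsilon>\<close>, where two distinct global maximizers coexist
(\<open>eventually_coexistence\<close>).

The curve is defined by a definite description, so it remains to see that the coexistence value of
\<open>\<beta>\<^sub>2\<close> is unique (\<open>coexistence_unique\<close>). Global maximizers lie inside \<open>(0, 1)\<close> and can
be written as \<open>u = K' \<theta>\<close> with \<open>K\<close> the cumulant generating function. In this coordinate \<open>L'\<close> is
\<open>D \<theta> = \<beta>\<^sub>1 + p \<beta>\<^sub>2 (K' \<theta>)\<^sup>p\<^sup>-\<^sup>1 - \<theta> / 2\<close>, which vanishes with \<open>D' \<le> 0\<close> at both of two coexisting maximizers,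
while \<open>D'\<close> vanishes in between; hence \<open>D'\<close> has an interior maximum, and the equation \<open>D'' = 0\<close> there is
exactly the critical equation. So the unique root \<open>\<theta>\<^sub>0\<close> of that equation separates every coexisting
pair. On the other hand, raising \<open>\<beta>\<^sub>2\<close> moves maximizers to the right (\<open>maximizers_monotone\<close>), so coexisting
pairs for two different values of \<open>\<beta>\<^sub>2\<close> occupy intervals without a common interior point: they cannot both surround \<open>\<theta>\<^sub>0\<close>.\<close>

section \<open>Two facts from real calculus\<close>

lemma abs_exp_minus_affine_le_square:
  fixes y :: real
  assumes "\<bar>y\<bar> \<le> 1"
  shows "\<bar>exp y - 1 - y\<bar> \<le> y\<^sup>2"
proof -
  have lower: "1 + y \<le> exp y"
    by (rule exp_ge_add_one_self)
  have upper: "exp y \<le> 1 + y + y\<^sup>2"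
  proof (cases "y \<ge> 0")
    case True
    then show ?thesis
      using assms by (intro exp_bound) auto
  next
    case False
    \<comment> \<open>For negative \<open>y\<close> compare with the reciprocal: \<open>1 \<le> (1 - y) (1 + y + y\<^sup>2)\<close>.\<close>
    have "1 - y \<le> exp (- y)"
      using exp_ge_add_one_self[of "- y"] by simp
    moreover have "0 \<le> 1 + y + y\<^sup>2"
      using assms by (smt (verit) zero_le_power2)
    moreover have "(1 - y) * (1 + y + y\<^sup>2) = 1 + y\<^sup>2 * (- y)"
      by (simp add: algebra_simps power2_eq_square)
    moreover have "0 \<le> y\<^sup>2 * (- y)"
      using False by (intro mult_nonneg_nonneg) auto
    ultimately have "1 \<le> exp (- y) * (1 + y + y\<^sup>2)"
      by (smt (verit) mult_right_mono)
    then have "exp y * 1 \<le> exp y * (exp (- y) * (1 + y + y\<^sup>2))"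
      by (intro mult_left_mono) auto
    also have "\<dots> = 1 + y + y\<^sup>2"
      by (simp add: exp_minus)
    finally show ?thesis by simp
  qed
  show ?thesis
    using lower upper zero_le_power2[of y] by linarith
qed

lemma ex_interior_critical_point:
  fixes f f' :: "real \<Rightarrow> real"
  assumes "a < w" "w < b" "f a \<le> f w" "f b \<le> f w"
    and der: "\<And>x. (f has_real_derivative f' x) (at x)"
  obtains z where "a < z" "z < b" "f' z = 0"
proof -
  have "continuous_on {a..b} f"
    using der by (meson DERIV_continuous_on DERIV_subset subset_UNIV)
  then obtain y where y: "y \<in> {a..b}" "\<forall>x\<in>{a..b}. f x \<le> f y"
    using continuous_attains_sup[of "{a..b}" f] assms(1,2) by force
  have "\<exists>z. a < z \<and> z < b \<and> (\<forall>x\<in>{a..b}. f x \<le> f z)"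
  proof (cases "a < y \<and> y < b")
    case True
    then show ?thesis using y by blast
  next
    case False
    then have "f y \<le> f w" using y(1) assms(3,4) by force
    then show ?thesis using y(2) assms(1,2) by force
  qed
  then obtain z where z: "a < z" "z < b" "\<forall>x\<in>{a..b}. f x \<le> f z" by blast
  have "f' z = 0"
  proof (rule DERIV_local_max[OF der, of "min (z - a) (b - z)"])
    show "0 < min (z - a) (b - z)" using z by simp
    show "\<forall>y. \<bar>z - y\<bar> < min (z - a) (b - z) \<longrightarrow> f y \<le> f z"
      using z(3) by (auto simp: abs_less_iff)
  qed
  with z that show thesis by blast
qed

section \<open>Cumulants of a symmetric law on the unit interval\<close>

locale edge_law = real_distribution \<mu> for \<mu> :: "real measure" +
  assumes support: "AE x in \<mu>. x \<in> {0..1}"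
    and nondegenerate: "nondegenerate \<mu>"
    and reflection: "distr \<mu> borel (\<lambda>x. 1 - x) = \<mu>"
    and rate_bounded: "\<exists>C::real. \<forall>u\<in>{0..1}. rate \<mu> u \<le> ereal C"
begin

abbreviation K :: "real \<Rightarrow> real" where
  "K \<equiv> cgf \<mu>"

definition tilted_moment :: "nat \<Rightarrow> real \<Rightarrow> real" where
  "tilted_moment n \<theta> = (\<integral>x. x ^ n * exp (\<theta> * x) \<partial>\<mu>)"

lemma tilted_weight_bound:
  assumes "x \<in> {0..1::real}"
  shows "\<bar>x ^ n * exp (\<theta> * x)\<bar> \<le> exp \<bar>\<theta>\<bar>"
proof -
  have "\<theta> * x \<le> \<bar>\<theta>\<bar> * 1"
    using assms by (intro order.trans[OF mult_right_mono mult_left_mono]) auto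
  then have "exp (\<theta> * x) \<le> exp \<bar>\<theta>\<bar>" by simp
  moreover have "x ^ n \<le> 1" using assms by (intro power_le_one) auto
  ultimately have "x ^ n * exp (\<theta> * x) \<le> 1 * exp \<bar>\<theta>\<bar>"
    using assms by (intro mult_mono) auto
  then show ?thesis using assms by (simp add: abs_mult)
qed

lemma integrable_tilted: "integrable \<mu> (\<lambda>x. x ^ n * exp (\<theta> * x))"
proof (rule integrable_const_bound[where B = "exp \<bar>\<theta>\<bar>"])
  show "AE x in \<mu>. norm (x ^ n * exp (\<theta> * x)) \<le> exp \<bar>\<theta>\<bar>"
    using support by eventually_elim (use tilted_weight_bound in auto)
qed measurable

lemma tilted_moment_0_pos: "0 < tilted_moment 0 \<theta>"
proof -
  have "exp (- \<bar>\<theta>\<bar>) \<le> (\<integral>x. x ^ 0 * exp (\<theta> * x) \<partial>\<mu>)"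
  proof (rule integral_ge_const[OF integrable_tilted])
    show "AE x in \<mu>. exp (- \<bar>\<theta>\<bar>) \<le> x ^ 0 * exp (\<theta> * x)"
      using support
    proof eventually_elim
      case (elim x)
      have "\<bar>\<theta> * x\<bar> \<le> \<bar>\<theta>\<bar> * 1"
        unfolding abs_mult using elim by (intro mult_left_mono) auto
      then show ?case by (simp add: abs_le_iff)
    qed
  qed
  then show ?thesis
    unfolding tilted_moment_def by (smt (verit) exp_gt_zero)
qed

lemma tilted_moment_nonneg: "0 \<le> tilted_moment n \<theta>"
  unfolding tilted_moment_def
proof (rule integral_nonneg_AE)
  show "AE x in \<mu>. 0 \<le> x ^ n * exp (\<theta> * x)"
    using support by eventually_elim auto
qed

text \<open>Differentiation under the integral: on the support the integrand of the difference quotient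
differs from that of the derivative by at most \<open>exp \<bar>\<theta>\<bar> * \<bar>h\<bar>\<close>, uniformly in \<open>x\<close>.\<close>

lemma tilted_moment_DERIV:
  "(tilted_moment n has_real_derivative tilted_moment (Suc n) \<theta>) (at \<theta>)"
proof -
  have bound: "\<bar>(tilted_moment n (\<theta> + h) - tilted_moment n \<theta>) / h - tilted_moment (Suc n) \<theta>\<bar>
      \<le> exp \<bar>\<theta>\<bar> * \<bar>h\<bar>" if h: "h \<noteq> 0" "\<bar>h\<bar> < 1" for h
  proof -
    have "\<bar>tilted_moment n (\<theta> + h) - tilted_moment n \<theta> - h * tilted_moment (Suc n) \<theta>\<bar>
      = \<bar>\<integral>x. x ^ n * exp ((\<theta> + h) * x) - x ^ n * exp (\<theta> * x) - h * (x ^ Suc n * exp (\<theta> * x)) \<partial>\<mu>\<bar>"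
      unfolding tilted_moment_def
      using integrable_tilted[of n "\<theta> + h"] integrable_tilted[of n \<theta>] integrable_tilted[of "Suc n" \<theta>]
      by (simp del: power_Suc)
    also have "\<dots> \<le> (\<integral>x. \<bar>x ^ n * exp ((\<theta> + h) * x) - x ^ n * exp (\<theta> * x)
        - h * (x ^ Suc n * exp (\<theta> * x))\<bar> \<partial>\<mu>)"
      by (rule integral_abs_bound)
    also have "\<dots> \<le> exp \<bar>\<theta>\<bar> * h\<^sup>2"
    proof (rule integral_le_const)
      show "integrable \<mu> (\<lambda>x. \<bar>x ^ n * exp ((\<theta> + h) * x) - x ^ n * exp (\<theta> * x)
          - h * (x ^ Suc n * exp (\<theta> * x))\<bar>)"
        by (intro integrable_abs Bochner_Integration.integrable_diff integrable_mult_right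
            integrable_tilted)
      show "AE x in \<mu>. \<bar>x ^ n * exp ((\<theta> + h) * x) - x ^ n * exp (\<theta> * x)
          - h * (x ^ Suc n * exp (\<theta> * x))\<bar> \<le> exp \<bar>\<theta>\<bar> * h\<^sup>2"
        using support
      proof eventually_elim
        case (elim x)
        have "\<bar>h * x\<bar> \<le> \<bar>h\<bar> * 1"
          unfolding abs_mult using elim by (intro mult_left_mono) auto
        then have hx: "\<bar>h * x\<bar> \<le> \<bar>h\<bar>" by simp
        then have "\<bar>exp (h * x) - 1 - h * x\<bar> \<le> (h * x)\<^sup>2"
          using h by (intro abs_exp_minus_affine_le_square) auto
        also have "\<dots> \<le> h\<^sup>2" using hx by (rule abs_le_square_iff[THEN iffD1])
        finally have e: "\<bar>exp (h * x) - 1 - h * x\<bar> \<le> h\<^sup>2" .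
        have "x ^ n * exp ((\<theta> + h) * x) - x ^ n * exp (\<theta> * x) - h * (x ^ Suc n * exp (\<theta> * x))
          = (x ^ n * exp (\<theta> * x)) * (exp (h * x) - 1 - h * x)"
          by (simp add: algebra_simps exp_add)
        then show ?case
          using mult_mono[OF tilted_weight_bound[OF elim] e] by (simp add: abs_mult)
      qed
    qed
    finally have "\<bar>tilted_moment n (\<theta> + h) - tilted_moment n \<theta> - h * tilted_moment (Suc n) \<theta>\<bar> / \<bar>h\<bar>
        \<le> exp \<bar>\<theta>\<bar> * h\<^sup>2 / \<bar>h\<bar>"
      by (intro divide_right_mono) auto
    moreover have "(tilted_moment n (\<theta> + h) - tilted_moment n \<theta>) / h - tilted_moment (Suc n) \<theta>
        = (tilted_moment n (\<theta> + h) - tilted_moment n \<theta> - h * tilted_moment (Suc n) \<theta>) / h"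
      using h by (simp add: diff_divide_distrib)
    moreover have "exp \<bar>\<theta>\<bar> * h\<^sup>2 / \<bar>h\<bar> = exp \<bar>\<theta>\<bar> * \<bar>h\<bar>"
      using h by (metis abs_zero abs_eq_0 nonzero_mult_div_cancel_right mult.assoc power2_abs power2_eq_square)
    ultimately show ?thesis
      by (simp only: abs_divide)
  qed
  have "((\<lambda>h. (tilted_moment n (\<theta> + h) - tilted_moment n \<theta>) / h - tilted_moment (Suc n) \<theta>)
      \<longlongrightarrow> 0) (at 0)"
  proof (rule Lim_null_comparison[where g = "\<lambda>h. exp \<bar>\<theta>\<bar> * \<bar>h\<bar>"])
    show "\<forall>\<^sub>F h in at 0. norm ((tilted_moment n (\<theta> + h) - tilted_moment n \<theta>) / h
        - tilted_moment (Suc n) \<theta>) \<le> exp \<bar>\<theta>\<bar> * \<bar>h\<bar>"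
      unfolding eventually_at by (intro exI[of _ 1]) (use bound in \<open>auto simp: dist_real_def\<close>)
    show "((\<lambda>h. exp \<bar>\<theta>\<bar> * \<bar>h\<bar>) \<longlongrightarrow> 0) (at 0)"
      by (auto intro!: tendsto_eq_intros)
  qed
  then show ?thesis
    unfolding DERIV_def using LIM_zero_iff by blast
qed

text \<open>The mean and the variance of the law \<open>\<mu>\<close> tilted by the density \<open>exp (\<theta> * x)\<close> and normalized. They are
the first and second derivatives of the cumulant generating function.\<close>

definition mean :: "real \<Rightarrow> real" where
  "mean \<theta> = tilted_moment 1 \<theta> / tilted_moment 0 \<theta>"

definition var :: "real \<Rightarrow> real" where
  "var \<theta> = tilted_moment 2 \<theta> / tilted_moment 0 \<theta> - (mean \<theta>)\<^sup>2"

lemma cgf_eq_ln_tilted_moment: "K \<theta> = ln (tilted_moment 0 \<theta>)"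
  by (simp add: cgf_def tilted_moment_def)

lemma cgf_DERIV: "(K has_real_derivative mean \<theta>) (at \<theta>)"
proof -
  have "((\<lambda>\<theta>. ln (tilted_moment 0 \<theta>)) has_real_derivative mean \<theta>) (at \<theta>)"
    unfolding mean_def using tilted_moment_0_pos[of \<theta>] tilted_moment_DERIV[of 0 \<theta>]
    by (auto intro!: derivative_eq_intros)
  then show ?thesis by (simp add: cgf_eq_ln_tilted_moment[abs_def])
qed

lemma mean_DERIV: "(mean has_real_derivative var \<theta>) (at \<theta>)"
proof -
  have "((\<lambda>\<theta>. tilted_moment 1 \<theta> / tilted_moment 0 \<theta>) has_real_derivative var \<theta>) (at \<theta>)"
    using tilted_moment_0_pos[of \<theta>] tilted_moment_DERIV[of 0 \<theta>] tilted_moment_DERIV[of 1 \<theta>]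
    by (auto intro!: derivative_eq_intros
        simp: var_def mean_def field_simps power2_eq_square numeral_2_eq_2)
  then show ?thesis by (simp add: mean_def[abs_def])
qed

lemma var_differentiable: "var differentiable (at \<theta>)"
proof -
  have "(\<lambda>\<theta>. tilted_moment 2 \<theta> / tilted_moment 0 \<theta> - (mean \<theta>)\<^sup>2) differentiable (at \<theta>)"
    using tilted_moment_0_pos[of \<theta>] tilted_moment_DERIV[of 0 \<theta>] tilted_moment_DERIV[of 2 \<theta>]
      mean_DERIV[of \<theta>]
    by (intro differentiable_diff differentiable_divide differentiable_power)
      (auto simp: real_differentiable_def)
  then show ?thesis by (simp add: var_def[abs_def])
qed

lemma var_DERIV: "(var has_real_derivative deriv var \<theta>) (at \<theta>)"
  using var_differentiable by (simp add: DERIV_deriv_iff_real_differentiable)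

lemma deriv_cgf: "deriv K = mean" "(deriv ^^ 2) K = var" "(deriv ^^ 3) K = deriv var"
proof -
  show 1: "deriv K = mean" by (rule ext) (rule DERIV_imp_deriv[OF cgf_DERIV])
  have 2: "deriv mean = var" by (rule ext) (rule DERIV_imp_deriv[OF mean_DERIV])
  show "(deriv ^^ 2) K = var" "(deriv ^^ 3) K = deriv var"
    by (simp_all add: numeral_2_eq_2 numeral_3_eq_3 1 2)
qed

text \<open>The integral of \<open>(x - mean \<theta>)\<^sup>2\<close> against the tilt can vanish only if \<open>\<mu>\<close> is a point mass.\<close>

lemma var_pos: "0 < var \<theta>"
proof -
  define a where "a = mean \<theta>"
  let ?m = "\<lambda>n. tilted_moment n \<theta>"
  let ?f = "\<lambda>x. (x - a)\<^sup>2 * exp (\<theta> * x)"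
  have f: "?f = (\<lambda>x. x ^ 2 * exp (\<theta> * x) - 2 * a * (x ^ 1 * exp (\<theta> * x))
      + a\<^sup>2 * (x ^ 0 * exp (\<theta> * x)))"
    by (rule ext) (simp add: power2_eq_square algebra_simps)
  have int: "integrable \<mu> ?f"
    unfolding f by (intro Bochner_Integration.integrable_add Bochner_Integration.integrable_diff
        integrable_mult_right integrable_tilted)
  have "(\<integral>x. ?f x \<partial>\<mu>) = ?m 2 - 2 * a * ?m 1 + a\<^sup>2 * ?m 0"
    unfolding f tilted_moment_def
    using integrable_tilted[of 0 \<theta>] integrable_tilted[of 1 \<theta>] integrable_tilted[of 2 \<theta>]
    by simp
  also have "\<dots> = var \<theta> * ?m 0"
    using tilted_moment_0_pos[of \<theta>]
    by (simp add: var_def a_def mean_def field_simps power2_eq_square)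
  finally have eq: "(\<integral>x. ?f x \<partial>\<mu>) = var \<theta> * ?m 0" .
  have "(\<integral>x. ?f x \<partial>\<mu>) \<noteq> 0"
  proof
    assume "(\<integral>x. ?f x \<partial>\<mu>) = 0"
    then have "AE x in \<mu>. ?f x = 0"
      using integral_nonneg_eq_0_iff_AE[OF int] by simp
    then have "AE x in \<mu>. x = a" by eventually_elim simp
    then show False using nondegenerate by (auto simp: nondegenerate_def)
  qed
  moreover have "0 \<le> (\<integral>x. ?f x \<partial>\<mu>)" by (rule integral_nonneg_AE) simp
  ultimately show ?thesis
    using eq tilted_moment_0_pos[of \<theta>] by (metis order_less_le zero_less_mult_pos2)
qed

lemma cgf_0: "K 0 = 0"
  using prob_space by (simp add: cgf_def)

lemma cgf_reflect: "K \<theta> = \<theta> + K (- \<theta>)"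
proof -
  have "(\<integral>x. exp (\<theta> * x) \<partial>\<mu>) = (\<integral>x. exp (\<theta> * x) \<partial>distr \<mu> borel (\<lambda>x. 1 - x))"
    by (simp add: reflection)
  also have "\<dots> = (\<integral>x. exp (\<theta> * (1 - x)) \<partial>\<mu>)"
    by (rule integral_distr) measurable
  also have "\<dots> = (\<integral>x. exp \<theta> * exp (- \<theta> * x) \<partial>\<mu>)"
    by (simp add: algebra_simps exp_diff exp_minus divide_inverse)
  also have "\<dots> = exp \<theta> * (\<integral>x. exp (- \<theta> * x) \<partial>\<mu>)"
    by simp
  finally have "tilted_moment 0 \<theta> = exp \<theta> * tilted_moment 0 (- \<theta>)"
    by (simp add: tilted_moment_def)
  then show ?thesis
    using tilted_moment_0_pos[of "- \<theta>"] by (simp add: cgf_eq_ln_tilted_moment ln_mult)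
qed

lemma mean_reflect: "mean \<theta> = 1 - mean (- \<theta>)"
proof -
  have "((\<lambda>\<theta>. \<theta> + K (- \<theta>)) has_real_derivative 1 - mean (- \<theta>)) (at \<theta>)"
    using cgf_DERIV[of "- \<theta>"] by (auto intro!: derivative_eq_intros DERIV_chain2[where f = K])
  then have "(K has_real_derivative 1 - mean (- \<theta>)) (at \<theta>)"
    by (simp flip: cgf_reflect)
  then show ?thesis using cgf_DERIV DERIV_unique by blast
qed

lemma mean_strict_mono:
  assumes "a < b"
  shows "mean a < mean b"
proof (rule DERIV_pos_imp_increasing[OF assms])
  show "\<exists>y. (mean has_real_derivative y) (at x) \<and> 0 < y" for x
    using mean_DERIV[of x] var_pos[of x] by (intro exI[of _ "var x"] conjI)
qed

text \<open>Convexity of \<open>K\<close>, in the tangent-line form that computes the Legendre transform.\<close>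

lemma cgf_tangent: "K \<theta> + mean \<theta> * (t - \<theta>) \<le> K t"
proof (cases t \<theta> rule: linorder_cases)
  case less
  then obtain z where "t < z" "z < \<theta>" "K \<theta> - K t = (\<theta> - t) * mean z"
    using MVT2[OF less, of K mean] cgf_DERIV by blast
  moreover from this have "(\<theta> - t) * mean z \<le> (\<theta> - t) * mean \<theta>"
    using mean_strict_mono by (intro mult_left_mono) (auto simp: less_imp_le)
  ultimately show ?thesis by (simp add: algebra_simps)
next
  case greater
  then obtain z where "\<theta> < z" "z < t" "K t - K \<theta> = (t - \<theta>) * mean z"
    using MVT2[OF greater, of K mean] cgf_DERIV by blast
  moreover from this have "(t - \<theta>) * mean \<theta> \<le> (t - \<theta>) * mean z"
    using mean_strict_mono by (intro mult_left_mono) (auto simp: less_imp_le)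
  ultimately show ?thesis by (simp add: algebra_simps)
qed simp

lemma mean_pos: "0 < mean \<theta>"
proof -
  have "0 \<le> mean (\<theta> - 1)"
    using tilted_moment_nonneg tilted_moment_0_pos by (simp add: mean_def less_imp_le)
  then show ?thesis using mean_strict_mono[of "\<theta> - 1" \<theta>] by simp
qed

lemma mean_less_1: "mean \<theta> < 1"
  using mean_reflect[of \<theta>] mean_pos[of "- \<theta>"] by simp

lemma cgf_nonpos: "\<theta> \<le> 0 \<Longrightarrow> K \<theta> \<le> 0"
  using cgf_tangent[of \<theta> 0] mult_nonneg_nonneg[of "mean \<theta>" "- \<theta>"] mean_pos[of \<theta>]
  by (simp add: cgf_0)

lemma cgf_le_self: "0 \<le> \<theta> \<Longrightarrow> K \<theta> \<le> \<theta>"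
  using cgf_nonpos[of "- \<theta>"] cgf_reflect[of \<theta>] by simp

section \<open>The rate function\<close>

definition J :: "real \<Rightarrow> real" where
  "J u = real_of_ereal (rate \<mu> u)"

text \<open>Outside the unit interval \<open>\<theta> u\<close> outgrows \<open>K \<theta>\<close> linearly in one direction, because \<open>K \<theta> \<le> max 0 \<theta>\<close>.\<close>

lemma rate_infinite:
  assumes "u \<notin> {0..1}"
  shows "rate \<mu> u = \<infinity>"
  unfolding rate_def
proof (rule SUP_PInfty)
  fix n :: nat
  show "\<exists>\<theta>\<in>UNIV. ereal (real n) \<le> ereal (\<theta> * u - K \<theta>)"
  proof (cases "u < 0")
    case True
    have "real n \<le> (real n / u) * u - K (real n / u)"
      using True cgf_nonpos[of "real n / u"] divide_nonneg_neg[of "real n" u] by force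
    then show ?thesis by (metis UNIV_I ereal_less_eq(3))
  next
    case False
    then have "0 < u - 1" using assms by simp
    define t where "t = real n / (u - 1)"
    have "0 \<le> t" using \<open>0 < u - 1\<close> by (simp add: t_def)
    moreover have "real n = t * u - t"
      using nonzero_eq_divide_eq[of "u - 1" t "real n"] \<open>0 < u - 1\<close>
      by (simp add: t_def right_diff_distrib)
    ultimately have "real n \<le> t * u - K t"
      using cgf_le_self[of t] by linarith
    then show ?thesis by auto
  qed
qed

lemma rate_eq_J:
  assumes "u \<in> {0..1}"
  shows "rate \<mu> u = ereal (J u)"
proof -
  obtain C where "rate \<mu> u \<le> ereal C" using rate_bounded assms by blast
  moreover have "ereal (0 * u - K 0) \<le> rate \<mu> u"
    unfolding rate_def by (rule SUP_upper) simp
  ultimately have "\<bar>rate \<mu> u\<bar> \<noteq> \<infinity>" by (cases "rate \<mu> u") auto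
  then show ?thesis unfolding J_def by (metis ereal_real)
qed

lemma rate_domain_eq: "rate_domain \<mu> = {0..1}"
proof -
  have "rate \<mu> u < \<infinity> \<longleftrightarrow> u \<in> {0..1}" for u
  proof (cases "u \<in> {0..1}")
    case True
    then show ?thesis using rate_eq_J[OF True] by simp
  next
    case False
    then show ?thesis using rate_infinite[OF False] by (simp only: less_irrefl)
  qed
  then show ?thesis by (simp only: rate_domain_def Collect_mem_eq)
qed

lemma J_upper:
  assumes "u \<in> {0..1}"
  shows "\<theta> * u - K \<theta> \<le> J u"
proof -
  have "ereal (\<theta> * u - K \<theta>) \<le> rate \<mu> u"
    unfolding rate_def by (rule SUP_upper) simp
  then show ?thesis by (simp add: rate_eq_J[OF assms])
qed

lemma J_least:
  assumes "u \<in> {0..1}" "\<And>\<theta>. \<theta> * u - K \<theta> \<le> c"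
  shows "J u \<le> c"
proof -
  have "rate \<mu> u \<le> ereal c"
    unfolding rate_def by (rule SUP_least) (use assms(2) in simp)
  then show ?thesis by (simp add: rate_eq_J[OF assms(1)])
qed

lemma J_nonneg: "u \<in> {0..1} \<Longrightarrow> 0 \<le> J u"
  using J_upper[of u 0] by (simp add: cgf_0)

text \<open>The supremum that defines the rate at \<open>mean \<theta>\<close> is attained at \<open>\<theta>\<close>, by the tangent inequality. Thus \<open>\<theta>\<close> is a
coordinate on the open interval in which the rate function and its slope \<open>\<theta>\<close> are explicit.\<close>

lemma J_mean: "J (mean \<theta>) = \<theta> * mean \<theta> - K \<theta>"
proof (rule antisym)
  have "mean \<theta> \<in> {0..1}" using mean_pos mean_less_1 by (auto simp: less_imp_le)
  then show "\<theta> * mean \<theta> - K \<theta> \<le> J (mean \<theta>)"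
    by (rule J_upper)
  show "J (mean \<theta>) \<le> \<theta> * mean \<theta> - K \<theta>"
  proof (rule J_least)
    show "t * mean \<theta> - K t \<le> \<theta> * mean \<theta> - K \<theta>" for t
      using cgf_tangent[of \<theta> t] by (simp add: algebra_simps)
  qed fact
qed

lemma J_1_eq_J_0: "J 1 = J 0"
proof (rule antisym)
  show "J 1 \<le> J 0"
  proof (rule J_least)
    fix \<theta>
    show "\<theta> * 1 - K \<theta> \<le> J 0" using J_upper[of 0 "- \<theta>"] cgf_reflect[of \<theta>] by simp
  qed simp
  show "J 0 \<le> J 1"
  proof (rule J_least)
    fix \<theta>
    show "\<theta> * 0 - K \<theta> \<le> J 1" using J_upper[of 1 "- \<theta>"] cgf_reflect[of \<theta>] by simp
  qed simp
qed

lemma J_convex: "convex_on {0..1} J"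
proof (rule convex_onI)
  fix t x y :: real
  assume t: "0 < t" "t < 1" and xy: "x \<in> {0..1}" "y \<in> {0..1}"
  define w where "w = (1 - t) * x + t * y"
  have "w \<in> {0..1}"
    using convexD[OF convex_real_interval(5)[of 0 1] xy, of "1 - t" t] t by (simp add: w_def)
  moreover have "\<theta> * w - K \<theta> \<le> (1 - t) * J x + t * J y" for \<theta>
  proof -
    have "\<theta> * w - K \<theta> = (1 - t) * (\<theta> * x - K \<theta>) + t * (\<theta> * y - K \<theta>)"
      by (simp add: w_def algebra_simps)
    also have "\<dots> \<le> (1 - t) * J x + t * J y"
      using t xy by (intro add_mono mult_left_mono J_upper) auto
    finally show ?thesis .
  qed
  ultimately show "J ((1 - t) *\<^sub>R x + t *\<^sub>R y) \<le> (1 - t) * J x + t * J y"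
    using J_least by (simp add: w_def)
qed simp

lemma J_le_J_0:
  assumes "u \<in> {0..1}"
  shows "J u \<le> J 0"
proof -
  have "J ((1 - u) *\<^sub>R 0 + u *\<^sub>R 1) \<le> (1 - u) * J 0 + u * J 1"
    by (rule convex_onD[OF J_convex]) (use assms in auto)
  also have "\<dots> = J 0"
    by (simp add: J_1_eq_J_0 left_diff_distrib)
  finally show ?thesis by simp
qed

text \<open>A supremum of affine functions is lower semicontinuous.\<close>

lemma J_lower_semicontinuous:
  assumes "a \<in> {0..1}" "c < J a"
  shows "\<forall>\<^sub>F u in at a within {0..1}. c < J u"
proof -
  obtain \<theta> where \<theta>: "c < \<theta> * a - K \<theta>"
    using J_least[OF assms(1), of c] assms(2) by (meson not_le)
  have "((\<lambda>u. \<theta> * u - K \<theta>) \<longlongrightarrow> \<theta> * a - K \<theta>) (at a within {0..1})"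
    by (intro tendsto_intros)
  then have "\<forall>\<^sub>F u in at a within {0..1}. c < \<theta> * u - K \<theta>"
    using \<theta> by (rule order_tendstoD)
  moreover have "\<forall>\<^sub>F u in at a within {0..1}. u \<in> {0..1}"
    by (simp add: eventually_at_filter)
  ultimately show ?thesis
    by eventually_elim (use J_upper less_le_trans in blast)
qed

lemma J_near:
  assumes "a \<in> {0..1}" "c < J a"
  obtains d where "0 < d" "\<And>u. u \<in> {0..1} \<Longrightarrow> \<bar>u - a\<bar> < d \<Longrightarrow> c < J u"
proof -
  obtain d where "0 < d" "\<forall>u\<in>{0..1}. u \<noteq> a \<and> dist u a < d \<longrightarrow> c < J u"
    using J_lower_semicontinuous[OF assms] unfolding eventually_at by blast
  then show thesis
    using that[of d] assms(2) by (metis dist_real_def)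
qed

text \<open>In the interior a convex function is continuous. At an end point, lower semicontinuity gives one half; the
other half is that the common end point value \<open>J 0 = J 1\<close> is the maximum of \<open>J\<close>.\<close>

lemma J_continuous: "continuous_on {0..1} J"
  unfolding continuous_on_def
proof
  fix a :: real assume a: "a \<in> {0..1}"
  show "(J \<longlongrightarrow> J a) (at a within {0..1})"
  proof (cases "a \<in> {0<..<1}")
    case True
    have "convex_on {0<..<1} J"
      using J_convex by (rule convex_on_subset) auto
    then have "continuous_on {0<..<1} J"
      by (intro convex_on_continuous) auto
    then have "isCont J a"
      using True by (simp add: continuous_on_eq_continuous_at)
    then show ?thesis
      unfolding isCont_def by (rule tendsto_within_subset) auto
  next
    case False
    then have Ja: "J a = J 0" using a J_1_eq_J_0 by force
    show ?thesis
    proof (rule order_tendstoI)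
      fix c assume "c < J a"
      with a show "\<forall>\<^sub>F u in at a within {0..1}. c < J u"
        by (rule J_lower_semicontinuous)
    next
      fix c assume "J a < c"
      then show "\<forall>\<^sub>F u in at a within {0..1}. J u < c"
        unfolding eventually_at_filter using J_le_J_0 Ja
        by (intro always_eventually) force
    qed
  qed
qed

text \<open>This is where finiteness of \<open>J 0\<close> matters: \<open>J 0\<close> is the supremum of \<open>- K\<close>, and if \<open>K\<close> had slope at least
\<open>e > 0\<close> everywhere, \<open>- K\<close> would be unbounded at \<open>-\<infinity>\<close>.\<close>

lemma mean_arbitrarily_small:
  assumes "0 < e"
  obtains \<theta> where "mean \<theta> < e"
proof (rule ccontr)
  assume "\<not> thesis"
  then have ge: "e \<le> mean \<theta>" for \<theta>
    using that[of \<theta>] not_le by blast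
  define t where "t = - (J 0 + 1) / e"
  have t: "t < 0" "e * t = - (J 0 + 1)"
    using assms J_nonneg[of 0] by (simp_all add: t_def divide_neg_pos)
  have "K t \<le> mean t * t" using cgf_tangent[of t 0] by (simp add: cgf_0)
  also have "\<dots> \<le> e * t" using ge t(1) by (intro mult_right_mono_neg) auto
  finally show False using J_upper[of 0 t] t(2) by simp
qed

lemma mean_onto:
  assumes "0 < u" "u < 1"
  obtains \<theta> where "u = mean \<theta>"
proof -
  obtain a where a: "mean a < u" using mean_arbitrarily_small assms(1) .
  obtain b' where "mean b' < 1 - u" using mean_arbitrarily_small assms(2) by (metis diff_gt_0_iff_gt)
  then have b: "u < mean (- b')" using mean_reflect[of b'] by simp
  have "a < - b'"
    using a b mean_strict_mono[of "- b'" a] by (cases a "- b'" rule: linorder_cases) auto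
  moreover have "continuous_on {a..- b'} mean"
    using mean_DERIV by (meson DERIV_continuous_on DERIV_subset subset_UNIV)
  ultimately obtain \<theta> where "mean \<theta> = u"
    using IVT'[of mean a u "- b'"] a b by force
  with that show thesis by blast
qed

end

section \<open>Global maximizers in the tilt coordinate\<close>

locale two_parameter_model = edge_law \<mu> for \<mu> +
  fixes p :: nat
  assumes p_ge_2: "2 \<le> p"
    and critical_unique: "\<exists>!\<theta>. critical_equation \<mu> p \<theta>"
begin

abbreviation L :: "real \<Rightarrow> real \<Rightarrow> real \<Rightarrow> real" where
  "L \<equiv> L_fun \<mu> p"

lemma L_eq: "L \<beta>\<^sub>1 \<beta>\<^sub>2 u = \<beta>\<^sub>1 * u + \<beta>\<^sub>2 * u ^ p - J u / 2"
  by (simp add: L_fun_def J_def)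

lemma L_0: "L \<beta>\<^sub>1 \<beta>\<^sub>2 0 = - J 0 / 2"
  using p_ge_2 by (simp add: L_eq zero_power)

lemma L_1: "L \<beta>\<^sub>1 \<beta>\<^sub>2 1 = \<beta>\<^sub>1 + \<beta>\<^sub>2 - J 0 / 2"
  by (simp add: L_eq J_1_eq_J_0)

lemma global_maximizer_iff:
  "global_maximizer \<mu> p \<beta>\<^sub>1 \<beta>\<^sub>2 u \<longleftrightarrow> u \<in> {0..1} \<and> (\<forall>v\<in>{0..1}. L \<beta>\<^sub>1 \<beta>\<^sub>2 v \<le> L \<beta>\<^sub>1 \<beta>\<^sub>2 u)"
  unfolding global_maximizer_def is_arg_max_linorder rate_domain_eq by blast

text \<open>At 0 and 1 the rate function has infinite slope, so neither is a maximizer. In terms of the tilt, a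
point \<open>mean \<theta>\<close> with \<open>\<theta>\<close> far enough to the left beats 0, and one with \<open>\<theta>\<close> far enough to the right beats 1.\<close>

lemma global_maximizer_interior:
  assumes G: "global_maximizer \<mu> p \<beta>\<^sub>1 \<beta>\<^sub>2 u" and "0 \<le> \<beta>\<^sub>2"
  obtains \<theta> where "u = mean \<theta>"
proof -
  have max: "L \<beta>\<^sub>1 \<beta>\<^sub>2 (mean \<theta>) \<le> L \<beta>\<^sub>1 \<beta>\<^sub>2 u" for \<theta>
    using G mean_pos[of \<theta>] mean_less_1[of \<theta>] by (auto simp: global_maximizer_iff)
  have L_mean: "L \<beta>\<^sub>1 \<beta>\<^sub>2 (mean \<theta>) = \<beta>\<^sub>1 * mean \<theta> + \<beta>\<^sub>2 * mean \<theta> ^ p - (\<theta> * mean \<theta> - K \<theta>) / 2" for \<theta>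
    by (simp add: L_eq J_mean)
  have "u \<noteq> 0"
  proof
    assume "u = 0"
    \<comment> \<open>Any \<open>\<theta> < 2 * \<beta>\<^sub>1\<close> makes \<open>\<beta>\<^sub>1 - \<theta> / 2\<close>, the guaranteed gain per unit of \<open>u\<close>, positive.\<close>
    define \<theta> where "\<theta> = 2 * \<beta>\<^sub>1 - 2"
    have "\<beta>\<^sub>1 * mean \<theta> - \<theta> * mean \<theta> / 2 = mean \<theta>"
      by (simp add: \<theta>_def left_diff_distrib diff_divide_distrib)
    moreover have "0 \<le> \<beta>\<^sub>2 * mean \<theta> ^ p"
      using assms(2) mean_pos[of \<theta>] by simp
    ultimately have "K \<theta> / 2 < L \<beta>\<^sub>1 \<beta>\<^sub>2 (mean \<theta>)"
      using mean_pos[of \<theta>] by (simp add: L_mean diff_divide_distrib)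
    moreover have "L \<beta>\<^sub>1 \<beta>\<^sub>2 0 \<le> K \<theta> / 2"
      using J_upper[of 0 \<theta>] by (simp add: L_0)
    ultimately show False using max[of \<theta>] \<open>u = 0\<close> by simp
  qed
  moreover have "u \<noteq> 1"
  proof
    assume "u = 1"
    \<comment> \<open>Moving left from 1 costs at most \<open>\<beta>\<^sub>1 + p * \<beta>\<^sub>2\<close> per unit, by the Bernoulli inequality, and gains \<open>\<theta> / 2\<close>.\<close>
    define \<theta> where "\<theta> = 2 * (\<beta>\<^sub>1 + real p * \<beta>\<^sub>2) + 2"
    define q where "q = 1 - mean \<theta>"
    have q: "0 < q" "q < 1" "mean \<theta> = 1 - q"
      using mean_pos[of \<theta>] mean_less_1[of \<theta>] by (simp_all add: q_def)
    have "1 - real p * q \<le> mean \<theta> ^ p"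
      using Bernoulli_inequality[of "- q" p] q by simp
    then have "\<beta>\<^sub>2 * (1 - real p * q) \<le> \<beta>\<^sub>2 * mean \<theta> ^ p"
      using assms(2) by (rule mult_left_mono)
    then have "\<beta>\<^sub>1 * (1 - q) + \<beta>\<^sub>2 * (1 - real p * q) - (\<theta> * (1 - q) - K \<theta>) / 2 \<le> L \<beta>\<^sub>1 \<beta>\<^sub>2 (mean \<theta>)"
      using L_mean[of \<theta>] unfolding q(3) by simp
    moreover have "\<beta>\<^sub>1 * (1 - q) + \<beta>\<^sub>2 * (1 - real p * q) - (\<theta> * (1 - q) - K \<theta>) / 2
        = \<beta>\<^sub>1 + \<beta>\<^sub>2 + q - (\<theta> - K \<theta>) / 2"
      by (simp add: \<theta>_def algebra_simps add_divide_distrib diff_divide_distrib)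
    moreover have "L \<beta>\<^sub>1 \<beta>\<^sub>2 1 \<le> \<beta>\<^sub>1 + \<beta>\<^sub>2 - (\<theta> - K \<theta>) / 2"
      using J_upper[of 1 \<theta>] by (simp add: L_1 J_1_eq_J_0)
    ultimately show False using max[of \<theta>] \<open>u = 1\<close> q(1) by simp
  qed
  ultimately have "0 < u" "u < 1"
    using G by (auto simp: global_maximizer_iff)
  then show thesis using mean_onto that by metis
qed

text \<open>The derivative of \<open>L\<close> with respect to \<open>u\<close>, at \<open>u = mean \<theta>\<close>; the term \<open>\<theta> / 2\<close> is half the slope of the
rate function there.\<close>

definition slope :: "real \<Rightarrow> real \<Rightarrow> real \<Rightarrow> real" where
  "slope \<beta>\<^sub>1 \<beta>\<^sub>2 \<theta> = \<beta>\<^sub>1 + real p * \<beta>\<^sub>2 * mean \<theta> ^ (p - 1) - \<theta> / 2"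

text \<open>The derivative of \<open>slope\<close> with respect to \<open>\<theta>\<close>. It depends on \<open>\<theta>\<close> only through \<open>K'' K'\<^sup>p\<^sup>-\<^sup>2\<close>, whose
stationary points are the roots of the critical equation.\<close>

definition slope' :: "real \<Rightarrow> real \<Rightarrow> real" where
  "slope' \<beta>\<^sub>2 \<theta> = real p * real (p - 1) * \<beta>\<^sub>2 * (mean \<theta> ^ (p - 2) * var \<theta>) - 1 / 2"

lemma L_mean_DERIV:
  "((\<lambda>\<theta>. L \<beta>\<^sub>1 \<beta>\<^sub>2 (mean \<theta>)) has_real_derivative slope \<beta>\<^sub>1 \<beta>\<^sub>2 \<theta> * var \<theta>) (at \<theta>)"
proof -
  have "((\<lambda>\<theta>. \<beta>\<^sub>1 * mean \<theta> + \<beta>\<^sub>2 * mean \<theta> ^ p - (\<theta> * mean \<theta> - K \<theta>) / 2)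
      has_real_derivative slope \<beta>\<^sub>1 \<beta>\<^sub>2 \<theta> * var \<theta>) (at \<theta>)"
    using mean_DERIV[of \<theta>] cgf_DERIV[of \<theta>]
    by (auto intro!: derivative_eq_intros simp: slope_def algebra_simps add_divide_distrib)
  then show ?thesis by (simp add: L_eq J_mean)
qed

lemma slope_DERIV: "(slope \<beta>\<^sub>1 \<beta>\<^sub>2 has_real_derivative slope' \<beta>\<^sub>2 \<theta>) (at \<theta>)"
proof -
  have "((\<lambda>\<theta>. \<beta>\<^sub>1 + real p * \<beta>\<^sub>2 * mean \<theta> ^ (p - 1) - \<theta> / 2) has_real_derivative
      real p * \<beta>\<^sub>2 * (real (p - 1) * mean \<theta> ^ (p - 1 - 1) * var \<theta>) - 1 / 2) (at \<theta>)"
    using mean_DERIV[of \<theta>] by (auto intro!: derivative_eq_intros)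
  moreover have "p - 1 - 1 = p - 2" by simp
  ultimately show ?thesis by (simp add: slope_def[abs_def] slope'_def algebra_simps)
qed

lemma slope'_DERIV:
  "(slope' \<beta>\<^sub>2 has_real_derivative real p * real (p - 1) * \<beta>\<^sub>2 *
      (mean \<theta> ^ (p - 2) * deriv var \<theta> + real (p - 2) * mean \<theta> ^ (p - 2 - 1) * var \<theta> * var \<theta>)) (at \<theta>)"
  unfolding slope'_def[abs_def] using mean_DERIV[of \<theta>] var_DERIV[of \<theta>]
  by (auto intro!: derivative_eq_intros simp: algebra_simps)

lemma critical_equation_if_slope'_stationary:
  assumes "(slope' \<beta>\<^sub>2 has_real_derivative 0) (at \<theta>)" "\<beta>\<^sub>2 \<noteq> 0"
  shows "critical_equation \<mu> p \<theta>"
proof -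
  let ?m = "mean \<theta>"
  obtain k where p: "p = Suc (Suc k)"
    using p_ge_2 by (metis add_2_eq_Suc le_Suc_ex)
  have "real p * real (p - 1) * \<beta>\<^sub>2 * (?m ^ k * deriv var \<theta> + real k * ?m ^ (k - 1) * var \<theta> * var \<theta>) = 0"
    using DERIV_unique[OF slope'_DERIV assms(1)] by (simp add: p)
  then have "?m ^ k * deriv var \<theta> + real k * ?m ^ (k - 1) * var \<theta> * var \<theta> = 0"
    using assms(2) by (simp add: p)
  \<comment> \<open>Multiplying by the mean turns the truncated exponent \<open>k - 1\<close> into \<open>k\<close>, also for \<open>k = 0\<close>.\<close>
  moreover have "?m ^ k * (deriv var \<theta> * ?m + real k * (var \<theta>)\<^sup>2)
      = ?m * (?m ^ k * deriv var \<theta> + real k * ?m ^ (k - 1) * var \<theta> * var \<theta>)"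
    by (cases k) (simp_all add: algebra_simps power2_eq_square)
  ultimately have "?m ^ k * (deriv var \<theta> * ?m + real k * (var \<theta>)\<^sup>2) = 0"
    by simp
  then have "deriv var \<theta> * ?m + real k * (var \<theta>)\<^sup>2 = 0"
    using mean_pos[of \<theta>] by simp
  then show ?thesis
    unfolding critical_equation_def deriv_cgf by (simp add: p)
qed

lemma maximizer_slope:
  assumes G: "global_maximizer \<mu> p \<beta>\<^sub>1 \<beta>\<^sub>2 (mean \<theta>)"
  shows "slope \<beta>\<^sub>1 \<beta>\<^sub>2 \<theta> = 0" "slope' \<beta>\<^sub>2 \<theta> \<le> 0"
proof -
  have max: "L \<beta>\<^sub>1 \<beta>\<^sub>2 (mean t) \<le> L \<beta>\<^sub>1 \<beta>\<^sub>2 (mean \<theta>)" for t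
    using G mean_pos[of t] mean_less_1[of t] by (auto simp: global_maximizer_iff)
  have "slope \<beta>\<^sub>1 \<beta>\<^sub>2 \<theta> * var \<theta> = 0"
    by (rule DERIV_local_max[OF L_mean_DERIV, of 1]) (use max in auto)
  then show zero: "slope \<beta>\<^sub>1 \<beta>\<^sub>2 \<theta> = 0" using var_pos[of \<theta>] by simp
  show "slope' \<beta>\<^sub>2 \<theta> \<le> 0"
  proof (rule ccontr)
    assume "\<not> slope' \<beta>\<^sub>2 \<theta> \<le> 0"
    then obtain d where d: "0 < d" "\<And>h. 0 < h \<Longrightarrow> h < d \<Longrightarrow> 0 < slope \<beta>\<^sub>1 \<beta>\<^sub>2 (\<theta> + h)"
      using DERIV_pos_inc_right[OF slope_DERIV] zero by (metis not_le)
    define t where "t = \<theta> + d / 2"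
    have "\<theta> < t" using d(1) by (simp add: t_def)
    then obtain z where z: "\<theta> < z" "z < t"
        "L \<beta>\<^sub>1 \<beta>\<^sub>2 (mean t) - L \<beta>\<^sub>1 \<beta>\<^sub>2 (mean \<theta>) = (t - \<theta>) * (slope \<beta>\<^sub>1 \<beta>\<^sub>2 z * var z)"
      using MVT2[of \<theta> t "\<lambda>\<theta>. L \<beta>\<^sub>1 \<beta>\<^sub>2 (mean \<theta>)" "\<lambda>z. slope \<beta>\<^sub>1 \<beta>\<^sub>2 z * var z"]
        L_mean_DERIV by blast
    moreover have "0 < slope \<beta>\<^sub>1 \<beta>\<^sub>2 z"
      using d(2)[of "z - \<theta>"] z(1,2) d(1) by (simp add: t_def)
    ultimately have "0 < L \<beta>\<^sub>1 \<beta>\<^sub>2 (mean t) - L \<beta>\<^sub>1 \<beta>\<^sub>2 (mean \<theta>)"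
      using \<open>\<theta> < t\<close> var_pos[of z] by simp
    then show False using max[of t] by simp
  qed
qed

text \<open>The slope vanishes at both maximizers, so by the mean value theorem \<open>slope'\<close> vanishes in between, whereas it is
nonpositive at both ends. It therefore has an interior maximum, hence a stationary point, between them.\<close>

lemma maximizers_bracket_critical_point:
  assumes "global_maximizer \<mu> p \<beta>\<^sub>1 \<beta>\<^sub>2 (mean s)" "global_maximizer \<mu> p \<beta>\<^sub>1 \<beta>\<^sub>2 (mean t)" "s < t"
  obtains z where "s < z" "z < t" "critical_equation \<mu> p z"
proof -
  obtain w where w: "s < w" "w < t" "slope \<beta>\<^sub>1 \<beta>\<^sub>2 t - slope \<beta>\<^sub>1 \<beta>\<^sub>2 s = (t - s) * slope' \<beta>\<^sub>2 w"
    using MVT2[OF assms(3)] slope_DERIV by blast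
  then have zero: "slope' \<beta>\<^sub>2 w = 0"
    using maximizer_slope(1)[OF assms(1)] maximizer_slope(1)[OF assms(2)] assms(3) by simp
  \<comment> \<open>For \<open>\<beta>\<^sub>2 = 0\<close> the function \<open>slope'\<close> would be the constant \<open>- 1 / 2\<close>.\<close>
  then have "\<beta>\<^sub>2 \<noteq> 0" by (auto simp: slope'_def)
  obtain z where z: "s < z" "z < t" "(slope' \<beta>\<^sub>2 has_real_derivative 0) (at z)"
    using ex_interior_critical_point[OF w(1,2) _ _ slope'_DERIV] zero slope'_DERIV
      maximizer_slope(2)[OF assms(1)] maximizer_slope(2)[OF assms(2)] by metis
  show thesis
    using that z(1,2) critical_equation_if_slope'_stationary[OF z(3) \<open>\<beta>\<^sub>2 \<noteq> 0\<close>] by blast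
qed

text \<open>The usual exchange argument for the supermodular term \<open>\<beta> u\<^sup>p\<close>: adding the two optimality
inequalities cancels every term that does not involve \<open>\<beta>' - \<beta>\<close>.\<close>

lemma maximizers_monotone:
  assumes "global_maximizer \<mu> p \<beta>\<^sub>1 \<beta> v" "global_maximizer \<mu> p \<beta>\<^sub>1 \<beta>' u" "\<beta> < \<beta>'"
  shows "v \<le> u"
proof -
  have uv: "u \<in> {0..1}" "v \<in> {0..1}" "L \<beta>\<^sub>1 \<beta> u \<le> L \<beta>\<^sub>1 \<beta> v" "L \<beta>\<^sub>1 \<beta>' v \<le> L \<beta>\<^sub>1 \<beta>' u"
    using assms(1,2) by (auto simp: global_maximizer_iff)
  then have "0 \<le> (\<beta>' - \<beta>) * (u ^ p - v ^ p)"
    by (simp add: L_eq algebra_simps)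
  then have "v ^ p \<le> u ^ p" using assms(3) by (simp add: zero_le_mult_iff)
  then show ?thesis
    using uv(1) p_ge_2 by (intro power_le_imp_le_base[of v "p - 1" u]) auto
qed

section \<open>Uniqueness of the coexistence value\<close>

definition coexistence :: "real \<Rightarrow> real \<Rightarrow> bool" where
  "coexistence \<beta>\<^sub>1 \<beta>\<^sub>2 \<longleftrightarrow> 0 \<le> \<beta>\<^sub>2 \<and>
    (\<exists>u v. u \<noteq> v \<and> global_maximizer \<mu> p \<beta>\<^sub>1 \<beta>\<^sub>2 u \<and> global_maximizer \<mu> p \<beta>\<^sub>1 \<beta>\<^sub>2 v)"

lemma coexistence_brackets:
  assumes "coexistence \<beta>\<^sub>1 \<beta>\<^sub>2"
  obtains s t z where "global_maximizer \<mu> p \<beta>\<^sub>1 \<beta>\<^sub>2 (mean s)" "global_maximizer \<mu> p \<beta>\<^sub>1 \<beta>\<^sub>2 (mean t)"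
    "s < z" "z < t" "critical_equation \<mu> p z"
proof -
  obtain u v where "0 \<le> \<beta>\<^sub>2" "u \<noteq> v" "global_maximizer \<mu> p \<beta>\<^sub>1 \<beta>\<^sub>2 u" "global_maximizer \<mu> p \<beta>\<^sub>1 \<beta>\<^sub>2 v"
    using assms by (auto simp: coexistence_def)
  then obtain a b where "a \<noteq> b"
      "global_maximizer \<mu> p \<beta>\<^sub>1 \<beta>\<^sub>2 (mean a)" "global_maximizer \<mu> p \<beta>\<^sub>1 \<beta>\<^sub>2 (mean b)"
    using global_maximizer_interior by metis
  then obtain s t where "s < t"
      "global_maximizer \<mu> p \<beta>\<^sub>1 \<beta>\<^sub>2 (mean s)" "global_maximizer \<mu> p \<beta>\<^sub>1 \<beta>\<^sub>2 (mean t)"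
    by (metis linorder_neqE)
  with that show thesis using maximizers_bracket_critical_point by metis
qed

text \<open>For \<open>\<beta> < \<beta>'\<close>, a maximizer at \<open>\<beta>\<close> to the right of the critical point would, by monotonicity, have to lie to
the left of a maximizer at \<open>\<beta>'\<close> that is itself to the left of the critical point.\<close>

lemma coexistence_not_less:
  assumes "coexistence \<beta>\<^sub>1 \<beta>" "coexistence \<beta>\<^sub>1 \<beta>'"
  shows "\<not> \<beta> < \<beta>'"
proof
  assume less: "\<beta> < \<beta>'"
  obtain t z where t: "global_maximizer \<mu> p \<beta>\<^sub>1 \<beta> (mean t)" "z < t" "critical_equation \<mu> p z"
    using coexistence_brackets[OF assms(1)] by metis
  obtain s z' where s: "global_maximizer \<mu> p \<beta>\<^sub>1 \<beta>' (mean s)" "s < z'" "critical_equation \<mu> p z'"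
    using coexistence_brackets[OF assms(2)] by metis
  have "z = z'" using critical_unique t(3) s(3) by blast
  then have "mean s < mean t" using s(2) t(2) by (intro mean_strict_mono) simp
  with maximizers_monotone[OF t(1) s(1) less] show False by simp
qed

lemma coexistence_unique: "coexistence \<beta>\<^sub>1 \<beta> \<Longrightarrow> coexistence \<beta>\<^sub>1 \<beta>' \<Longrightarrow> \<beta> = \<beta>'"
  using coexistence_not_less by (meson linorder_neqE)

lemma transition_curve_eq:
  assumes "coexistence \<beta>\<^sub>1 \<beta>\<^sub>2" "\<beta>\<^sub>1 \<noteq> beta1c \<mu> p"
  shows "transition_curve \<mu> p \<beta>\<^sub>1 = \<beta>\<^sub>2"
proof -
  have "transition_curve \<mu> p \<beta>\<^sub>1 = (THE \<beta>. coexistence \<beta>\<^sub>1 \<beta>)"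
    using assms(2) by (simp add: transition_curve_def coexistence_def)
  also have "\<dots> = \<beta>\<^sub>2"
    using assms(1) coexistence_unique by (intro the_equality) blast+
  finally show ?thesis .
qed

section \<open>Existence of a coexistence value near the asymptote\<close>

lemma power_p_le_square:
  assumes "w \<in> {0..1::real}"
  shows "w ^ p \<le> w * w"
  using power_decreasing[of 2 p w] p_ge_2 assms by (simp add: power2_eq_square)

text \<open>Here \<open>L 1 - L w = \<epsilon> (1 - w\<^sup>p) - \<beta>\<^sub>1 (w - w\<^sup>p) + (J w - J 0) / 2\<close>. Only the last term can be negative. Close to
0 it is small by lower semicontinuity and the first term dominates it; away from 0 it is bounded below, and the second term is
large.\<close>

lemma eventually_lower_half_loses:
  assumes "0 < \<epsilon>"
  shows "\<forall>\<^sub>F \<beta>\<^sub>1 in at_bot. \<forall>w\<in>{0..1/2}. L \<beta>\<^sub>1 (\<epsilon> - \<beta>\<^sub>1) w < L \<beta>\<^sub>1 (\<epsilon> - \<beta>\<^sub>1) 1"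
proof -
  obtain d where d: "0 < d" "\<And>w. w \<in> {0..1} \<Longrightarrow> \<bar>w - 0\<bar> < d \<Longrightarrow> J 0 - \<epsilon> < J w"
    using J_near[of 0 "J 0 - \<epsilon>"] assms by auto
  show ?thesis
    using eventually_gt_at_bot[of "min 0 (- (J 0 / d))"]
  proof eventually_elim
    case (elim \<beta>\<^sub>1)
    then have b: "\<beta>\<^sub>1 < 0" "J 0 < - \<beta>\<^sub>1 * d"
      using d(1) by (simp_all add: field_simps)
    show ?case
    proof
      fix w :: real assume w: "w \<in> {0..1/2}"
      have "w * w \<le> w * (1 / 2)" using w by (intro mult_left_mono) auto
      then have wp: "w ^ p \<le> w / 2" using power_p_le_square[of w] w by simp
      define g k where "g = \<epsilon> * (1 - w ^ p)" and "k = - \<beta>\<^sub>1 * (w - w ^ p)"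
      have gain: "\<epsilon> * (3 / 4) \<le> g"
        unfolding g_def using wp w assms by (intro mult_left_mono) auto
      have cost: "- \<beta>\<^sub>1 * (w / 2) \<le> k"
        unfolding k_def using wp b(1) by (intro mult_left_mono) auto
      have diff: "L \<beta>\<^sub>1 (\<epsilon> - \<beta>\<^sub>1) 1 - L \<beta>\<^sub>1 (\<epsilon> - \<beta>\<^sub>1) w
          = g + k + (J w - J 0) / 2"
        by (simp add: L_1) (simp add: L_eq g_def k_def algebra_simps diff_divide_distrib)
      show "L \<beta>\<^sub>1 (\<epsilon> - \<beta>\<^sub>1) w < L \<beta>\<^sub>1 (\<epsilon> - \<beta>\<^sub>1) 1"
      proof (cases "w < d")
        case True
        have "0 \<le> - \<beta>\<^sub>1 * (w / 2)" using b(1) w by (intro mult_nonneg_nonneg) auto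
        then have "0 \<le> k" using cost by (rule order.trans)
        moreover have "J 0 - \<epsilon> < J w" using d(2)[of w] True w by simp
        ultimately show ?thesis using gain diff assms by argo
      next
        case False
        then have "- \<beta>\<^sub>1 * d \<le> - \<beta>\<^sub>1 * w" using b(1) by (intro mult_left_mono) auto
        then have "J 0 < - \<beta>\<^sub>1 * w" using b(2) by linarith
        then have "J 0 / 2 < k" using cost by (simp add: mult.assoc)
        moreover have "0 \<le> J w" using w by (intro J_nonneg) auto
        ultimately show ?thesis using gain diff assms by argo
      qed
    qed
  qed
qed

text \<open>The mirror image: \<open>L 0 - L w = \<epsilon> w\<^sup>p - \<beta>\<^sub>1 (w - w\<^sup>p) + (J w - J 0) / 2\<close>, where now lower semicontinuity is
used at 1 and the first term is at least \<open>\<epsilon> / 2\<^sup>p\<close>.\<close>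

lemma eventually_upper_half_loses:
  assumes "0 < \<epsilon>"
  shows "\<forall>\<^sub>F \<beta>\<^sub>1 in at_bot. \<forall>w\<in>{1/2..1}. L \<beta>\<^sub>1 (- \<epsilon> - \<beta>\<^sub>1) w < L \<beta>\<^sub>1 (- \<epsilon> - \<beta>\<^sub>1) 0"
proof -
  define c where "c = \<epsilon> * (1 / 2) ^ p"
  have "0 < c" using assms by (simp add: c_def)
  then obtain d where d: "0 < d" "\<And>w. w \<in> {0..1} \<Longrightarrow> \<bar>w - 1\<bar> < d \<Longrightarrow> J 0 - c < J w"
    using J_near[of 1 "J 0 - c"] J_1_eq_J_0 by auto
  show ?thesis
    using eventually_gt_at_bot[of "min 0 (- (J 0 / d))"]
  proof eventually_elim
    case (elim \<beta>\<^sub>1)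
    then have b: "\<beta>\<^sub>1 < 0" "J 0 < - \<beta>\<^sub>1 * d"
      using d(1) by (simp_all add: field_simps)
    show ?case
    proof
      fix w :: real assume w: "w \<in> {1/2..1}"
      have "w * w + (1 - w) / 2 \<le> w"
        using mult_right_mono[of "1 / 2" w "1 - w"] w by (simp add: algebra_simps)
      moreover have "w ^ p \<le> w * w" using w by (intro power_p_le_square) auto
      ultimately have wp: "(1 - w) / 2 \<le> w - w ^ p" by linarith
      define g k where "g = \<epsilon> * w ^ p" and "k = - \<beta>\<^sub>1 * (w - w ^ p)"
      have gain: "c \<le> g"
        unfolding c_def g_def using w assms by (intro mult_left_mono power_mono) auto
      have cost: "- \<beta>\<^sub>1 * ((1 - w) / 2) \<le> k"
        unfolding k_def using wp b(1) by (intro mult_left_mono) auto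
      have diff: "L \<beta>\<^sub>1 (- \<epsilon> - \<beta>\<^sub>1) 0 - L \<beta>\<^sub>1 (- \<epsilon> - \<beta>\<^sub>1) w
          = g + k + (J w - J 0) / 2"
        by (simp add: L_0) (simp add: L_eq g_def k_def algebra_simps diff_divide_distrib)
      show "L \<beta>\<^sub>1 (- \<epsilon> - \<beta>\<^sub>1) w < L \<beta>\<^sub>1 (- \<epsilon> - \<beta>\<^sub>1) 0"
      proof (cases "1 - w < d")
        case True
        have "0 \<le> - \<beta>\<^sub>1 * ((1 - w) / 2)" using b(1) w by (intro mult_nonneg_nonneg) auto
        then have "0 \<le> k" using cost by (rule order.trans)
        moreover have "J 0 - c < J w" using d(2)[of w] True w by simp
        ultimately show ?thesis using gain diff \<open>0 < c\<close> by argo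
      next
        case False
        then have "- \<beta>\<^sub>1 * d \<le> - \<beta>\<^sub>1 * (1 - w)" using b(1) by (intro mult_left_mono) auto
        then have "J 0 < - \<beta>\<^sub>1 * (1 - w)" using b(2) by linarith
        then have "J 0 / 2 < k" using cost by (simp add: mult.assoc)
        moreover have "0 \<le> J w" using w by (intro J_nonneg) auto
        ultimately show ?thesis using gain diff \<open>0 < c\<close> by argo
      qed
    qed
  qed
qed

text \<open>Maximizers found separately in \<open>[0, 1/2]\<close> and in \<open>[1/2, 1]\<close> could only coincide at \<open>1/2\<close>, which this rules out.\<close>

lemma eventually_half_loses:
  "\<forall>\<^sub>F \<beta>\<^sub>1 in at_bot. \<forall>\<beta>\<^sub>2\<le>\<epsilon> - \<beta>\<^sub>1. L \<beta>\<^sub>1 \<beta>\<^sub>2 (1/2) < L \<beta>\<^sub>1 \<beta>\<^sub>2 0"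
  using eventually_gt_at_bot[of "min \<epsilon> (- \<epsilon> - 2 * J 0)"]
proof eventually_elim
  case (elim \<beta>\<^sub>1)
  show ?case
  proof (intro allI impI)
    fix \<beta>\<^sub>2 assume "\<beta>\<^sub>2 \<le> \<epsilon> - \<beta>\<^sub>1"
    then have "\<beta>\<^sub>2 * (1/2) ^ p \<le> (\<epsilon> - \<beta>\<^sub>1) * (1/2) ^ p" by (intro mult_right_mono) auto
    also have "\<dots> \<le> (\<epsilon> - \<beta>\<^sub>1) * (1 / 2 * (1 / 2))"
      using elim by (intro mult_left_mono power_p_le_square) auto
    finally show "L \<beta>\<^sub>1 \<beta>\<^sub>2 (1/2) < L \<beta>\<^sub>1 \<beta>\<^sub>2 0"
      using elim J_nonneg[of "1/2"] by (simp add: L_0) (simp add: L_eq)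
  qed
qed

text \<open>The maximum over \<open>A\<close> is a supremum of functions of \<open>\<beta>\<close> that are affine with slope \<open>u\<^sup>p\<close> in \<open>[0, 1]\<close>, so it is
Lipschitz with constant 1.\<close>

lemma restricted_maximizers:
  assumes "closed A" "A \<subseteq> {0..1}" "A \<noteq> {}"
  obtains m where "\<And>\<beta>. m \<beta> \<in> A" "\<And>\<beta> u. u \<in> A \<Longrightarrow> L \<beta>\<^sub>1 \<beta> u \<le> L \<beta>\<^sub>1 \<beta> (m \<beta>)"
    "continuous_on UNIV (\<lambda>\<beta>. L \<beta>\<^sub>1 \<beta> (m \<beta>))"
proof -
  have "compact A"
    using assms(1,2) compact_Icc[of 0 "1::real"] by (metis compact_Int_closed inf.absorb_iff2)
  have "\<exists>x\<in>A. \<forall>u\<in>A. L \<beta>\<^sub>1 \<beta> u \<le> L \<beta>\<^sub>1 \<beta> x" for \<beta>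
  proof (rule continuous_attains_sup[OF \<open>compact A\<close> assms(3)])
    show "continuous_on A (L \<beta>\<^sub>1 \<beta>)"
      unfolding L_eq[abs_def]
      by (intro continuous_intros continuous_on_subset[OF J_continuous assms(2)]) auto
  qed
  then obtain m where m: "\<And>\<beta>. m \<beta> \<in> A" "\<And>\<beta> u. u \<in> A \<Longrightarrow> L \<beta>\<^sub>1 \<beta> u \<le> L \<beta>\<^sub>1 \<beta> (m \<beta>)"
    by metis
  have upper: "L \<beta>\<^sub>1 \<beta> (m \<beta>) - L \<beta>\<^sub>1 \<beta>' (m \<beta>') \<le> \<bar>\<beta> - \<beta>'\<bar>" for \<beta> \<beta>'
  proof -
    have "L \<beta>\<^sub>1 \<beta> (m \<beta>) - L \<beta>\<^sub>1 \<beta>' (m \<beta>') \<le> L \<beta>\<^sub>1 \<beta> (m \<beta>) - L \<beta>\<^sub>1 \<beta>' (m \<beta>)"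
      using m(2)[OF m(1)[of \<beta>], of \<beta>'] by simp
    also have "\<dots> = (\<beta> - \<beta>') * m \<beta> ^ p"
      by (simp add: L_eq algebra_simps)
    also have "\<dots> \<le> \<bar>\<beta> - \<beta>'\<bar> * 1"
      using assms(2) m(1)[of \<beta>] by (intro mult_mono power_le_one) auto
    finally show ?thesis by simp
  qed
  have "1-lipschitz_on UNIV (\<lambda>\<beta>. L \<beta>\<^sub>1 \<beta> (m \<beta>))"
  proof (rule lipschitz_onI)
    show "dist (L \<beta>\<^sub>1 \<beta> (m \<beta>)) (L \<beta>\<^sub>1 \<beta>' (m \<beta>')) \<le> 1 * dist \<beta> \<beta>'" for \<beta> \<beta>'
      using upper[of \<beta> \<beta>'] upper[of \<beta>' \<beta>] by (simp add: dist_real_def abs_le_iff)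
  qed simp
  with that m show thesis using lipschitz_on_continuous_on by blast
qed

text \<open>The intermediate value theorem for the difference of the maxima over the two halves, between
\<open>\<beta>\<^sub>2 = - \<epsilon> - \<beta>\<^sub>1\<close> and \<open>\<beta>\<^sub>2 = \<epsilon> - \<beta>\<^sub>1\<close>.\<close>

lemma eventually_coexistence:
  assumes "0 < \<epsilon>"
  shows "\<forall>\<^sub>F \<beta>\<^sub>1 in at_bot. \<exists>\<beta>\<^sub>2. coexistence \<beta>\<^sub>1 \<beta>\<^sub>2 \<and> \<bar>\<beta>\<^sub>2 + \<beta>\<^sub>1\<bar> \<le> \<epsilon>"
  using eventually_lower_half_loses[OF assms] eventually_upper_half_loses[OF assms]
    eventually_half_loses[of \<epsilon>] eventually_gt_at_bot[of "- \<epsilon>"]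
proof eventually_elim
  case (elim \<beta>\<^sub>1)
  obtain l where l: "\<And>\<beta>. l \<beta> \<in> {0..1/2}" "\<And>\<beta> u. u \<in> {0..1/2} \<Longrightarrow> L \<beta>\<^sub>1 \<beta> u \<le> L \<beta>\<^sub>1 \<beta> (l \<beta>)"
      "continuous_on UNIV (\<lambda>\<beta>. L \<beta>\<^sub>1 \<beta> (l \<beta>))"
    by (rule restricted_maximizers[of "{0..1/2}" \<beta>\<^sub>1]) auto
  obtain h where h: "\<And>\<beta>. h \<beta> \<in> {1/2..1}" "\<And>\<beta> u. u \<in> {1/2..1} \<Longrightarrow> L \<beta>\<^sub>1 \<beta> u \<le> L \<beta>\<^sub>1 \<beta> (h \<beta>)"
      "continuous_on UNIV (\<lambda>\<beta>. L \<beta>\<^sub>1 \<beta> (h \<beta>))"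
    by (rule restricted_maximizers[of "{1/2..1}" \<beta>\<^sub>1]) auto
  define gap where "gap \<beta> = L \<beta>\<^sub>1 \<beta> (h \<beta>) - L \<beta>\<^sub>1 \<beta> (l \<beta>)" for \<beta>
  have "gap (- \<epsilon> - \<beta>\<^sub>1) \<le> 0"
    using bspec[OF elim(2) h(1)[of "- \<epsilon> - \<beta>\<^sub>1"]] l(2)[of 0 "- \<epsilon> - \<beta>\<^sub>1"] by (simp add: gap_def)
  moreover have "0 \<le> gap (\<epsilon> - \<beta>\<^sub>1)"
    using bspec[OF elim(1) l(1)[of "\<epsilon> - \<beta>\<^sub>1"]] h(2)[of 1 "\<epsilon> - \<beta>\<^sub>1"] by (simp add: gap_def)
  moreover have "continuous_on {- \<epsilon> - \<beta>\<^sub>1..\<epsilon> - \<beta>\<^sub>1} gap"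
    unfolding gap_def[abs_def]
    by (intro continuous_intros continuous_on_subset[OF h(3)] continuous_on_subset[OF l(3)]) auto
  ultimately obtain \<beta>\<^sub>2 where \<beta>\<^sub>2: "- \<epsilon> - \<beta>\<^sub>1 \<le> \<beta>\<^sub>2" "\<beta>\<^sub>2 \<le> \<epsilon> - \<beta>\<^sub>1" "gap \<beta>\<^sub>2 = 0"
    using IVT'[of gap "- \<epsilon> - \<beta>\<^sub>1" 0 "\<epsilon> - \<beta>\<^sub>1"] assms by auto
  have eq: "L \<beta>\<^sub>1 \<beta>\<^sub>2 (h \<beta>\<^sub>2) = L \<beta>\<^sub>1 \<beta>\<^sub>2 (l \<beta>\<^sub>2)" using \<beta>\<^sub>2(3) by (simp add: gap_def)
  have "L \<beta>\<^sub>1 \<beta>\<^sub>2 u \<le> L \<beta>\<^sub>1 \<beta>\<^sub>2 (l \<beta>\<^sub>2)" if "u \<in> {0..1}" for u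
    using l(2)[of u \<beta>\<^sub>2] h(2)[of u \<beta>\<^sub>2] eq that by (cases "u \<le> 1/2") auto
  then have G: "global_maximizer \<mu> p \<beta>\<^sub>1 \<beta>\<^sub>2 (l \<beta>\<^sub>2)" "global_maximizer \<mu> p \<beta>\<^sub>1 \<beta>\<^sub>2 (h \<beta>\<^sub>2)"
    using l(1)[of \<beta>\<^sub>2] h(1)[of \<beta>\<^sub>2] eq by (auto simp: global_maximizer_iff)
  have "l \<beta>\<^sub>2 \<noteq> h \<beta>\<^sub>2"
  proof
    assume "l \<beta>\<^sub>2 = h \<beta>\<^sub>2"
    then have "l \<beta>\<^sub>2 = 1/2" using l(1)[of \<beta>\<^sub>2] h(1)[of \<beta>\<^sub>2] by auto
    moreover have "L \<beta>\<^sub>1 \<beta>\<^sub>2 0 \<le> L \<beta>\<^sub>1 \<beta>\<^sub>2 (l \<beta>\<^sub>2)" by (rule l(2)) simp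
    ultimately show False using elim(3) \<beta>\<^sub>2(2) by (metis not_less)
  qed
  moreover have "0 \<le> \<beta>\<^sub>2" "\<bar>\<beta>\<^sub>2 + \<beta>\<^sub>1\<bar> \<le> \<epsilon>" using \<beta>\<^sub>2(1,2) elim(4) by auto
  ultimately show ?case using G unfolding coexistence_def by blast
qed

section \<open>The asymptote of the transition curve\<close>

theorem transition_curve_asymptote:
  "((\<lambda>\<beta>\<^sub>1. \<bar>transition_curve \<mu> p \<beta>\<^sub>1 + \<beta>\<^sub>1\<bar>) \<longlongrightarrow> 0) at_bot"
proof (rule tendstoI)
  fix e :: real assume "0 < e"
  then have "\<forall>\<^sub>F \<beta>\<^sub>1 in at_bot. \<exists>\<beta>\<^sub>2. coexistence \<beta>\<^sub>1 \<beta>\<^sub>2 \<and> \<bar>\<beta>\<^sub>2 + \<beta>\<^sub>1\<bar> \<le> e / 2"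
    by (intro eventually_coexistence) simp
  then show "\<forall>\<^sub>F \<beta>\<^sub>1 in at_bot. dist \<bar>transition_curve \<mu> p \<beta>\<^sub>1 + \<beta>\<^sub>1\<bar> 0 < e"
    using eventually_gt_at_bot[of "beta1c \<mu> p"]
  proof eventually_elim
    case (elim \<beta>\<^sub>1)
    then obtain \<beta>\<^sub>2 where "coexistence \<beta>\<^sub>1 \<beta>\<^sub>2" "\<bar>\<beta>\<^sub>2 + \<beta>\<^sub>1\<bar> \<le> e / 2" by blast
    then show ?case using transition_curve_eq elim(2) \<open>0 < e\<close> by simp
  qed
qed

end

theorem proposition3:
  fixes \<mu> :: "real measure" and V :: "'v set" and E :: "'v set set" and p :: nat
  assumes "real_distribution \<mu>"
    and "AE x in \<mu>. x \<in> {0..1}"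
    and "nondegenerate \<mu>"
    and "distr \<mu> borel (\<lambda>x. 1 - x) = \<mu>"
    and "\<exists>C::real. \<forall>u\<in>{0..1}. rate \<mu> u \<le> ereal C"
    and "simple_graph V E" and "card E = p" and "p \<ge> 2"
    and "\<exists>!\<theta>. critical_equation \<mu> p \<theta>"
  shows "((\<lambda>\<beta>\<^sub>1. \<bar>transition_curve \<mu> p \<beta>\<^sub>1 + \<beta>\<^sub>1\<bar>) \<longlongrightarrow> 0) at_bot"
proof -
  interpret real_distribution \<mu> by fact
  interpret two_parameter_model \<mu> p
    by unfold_locales fact+
  show ?thesis by (rule transition_curve_asymptote)
qed

end
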